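(* Let $\alpha,\beta>-1$ and let $P^{(\alpha,\beta)}_{n,k}(x,y)$, $0\le k\le n$, be the Koornwinder polynomials on the parabolic biangle. If $k\geq 0$ and $n\geq k+1$, then $$\frac{\partial}{\partial \alpha} P^{(\alpha,\beta)}_{n,k}(x,y)=\sum_{s=0}^{n-k-1}\frac{1}{\alpha+\beta+n+s+\frac{3}{2}}\,P^{(\alpha,\beta)}_{n,k}(x,y)+\sum_{s=0}^{n-k-1}\frac{(\alpha+\beta+2n-k-2s-\frac{1}{2})\,(\beta+n-s+\frac{1}{2})_{s+1}}{(s+1)(\alpha+\beta+2n-k-s+\frac{1}{2})\,(\alpha+\beta+n-s+\frac{1}{2})_{s+1}}\, P^{(\alpha,\beta)}_{n-s-1,k}(x,y),$$ and if $n=k\geq 0$, then $\frac{\partial}{\partial \alpha} P^{(\alpha,\beta)}_{n,n}(x,y)=0$.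
   Context: The classical Jacobi polynomials are $P_{n}^{(a,b)}(x)=\frac{(-1)^{n}}{2^{n}n!}(1-x)^{-a}(1+x)^{-b}\frac{d^{n}}{dx^{n}}\{(1-x)^{n+a}(1+x)^{n+b}\}$. The Pochhammer symbol is $(a)_0=1$, $(a)_k=a(a+1)\cdots(a+k-1)$ for $k\ge1$. For $\alpha,\beta>-1$ and integers $0\le k\le n$, the Koornwinder polynomials on the parabolic biangle $\Omega=\{(x,y): y^{2}\leq x \leq 1\}$ are $$P^{(\alpha,\beta)}_{n,k}(x,y)=P^{(\alpha,\beta+k+\frac{1}{2})}_{n-k}(2x-1)\,x^{k/2}\,P^{(\beta,\beta)}_{k}\!\left(\frac{y}{\sqrt{x}}\right),$$ where the factors on the right are one-variable Jacobi polynomials.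
   Formalization: For k=0, s=n-1 and α+β=-3/2 the printed coefficient of P_{n-s-1,k} is 0/0 (common factor α+β+3/2); there it is read as its limit in α with β fixed; everywhere else the printed quotient is used unchanged. *)

theory Defs
  imports "HOL-Analysis.Analysis" "HOL-Computational_Algebra.Polynomial"
begin

text \<open>
  Rodrigues' formula makes literal sense on \<open>{-1<..<1}\<close>, where the bases of the real powers are
  positive. The Jacobi polynomial is the unique polynomial that agrees with it there, so that it
  can be evaluated at the endpoints as well.
\<close>

definition jacobi_rodrigues :: "nat \<Rightarrow> real \<Rightarrow> real \<Rightarrow> real \<Rightarrow> real" where
  "jacobi_rodrigues n a b x =
     (-1) ^ n / (2 ^ n * fact n) * (1 - x) powr (- a) * (1 + x) powr (- b) *
     (deriv ^^ n) (\<lambda>t. (1 - t) powr (real n + a) * (1 + t) powr (real n + b)) x"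

definition jacobi_poly :: "nat \<Rightarrow> real \<Rightarrow> real \<Rightarrow> real poly" where
  "jacobi_poly n a b = (THE p. \<forall>x\<in>{-1<..<1}. poly p x = jacobi_rodrigues n a b x)"

definition parabolic_biangle :: "(real \<times> real) set" where
  "parabolic_biangle = {(x, y). y\<^sup>2 \<le> x \<and> x \<le> 1}"

text \<open>
  The factor \<open>x\<^bsup>k/2\<^esup>\<close> is written \<open>sqrt x ^ k\<close>. At the origin, the only point of the biangle with
  \<open>x = 0\<close>, this gives \<open>0 ^ k * P\<^sub>k(0)\<close>, i.e. 0 for \<open>k > 0\<close> and 1 for \<open>k = 0\<close>, which is the value of
  the bivariate polynomial \<open>x\<^bsup>k/2\<^esup> P\<^sub>k(y / sqrt x)\<close> (with \<open>powr\<close> the case \<open>k = 0\<close> would be wrong).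
\<close>

definition koornwinder :: "real \<Rightarrow> real \<Rightarrow> nat \<Rightarrow> nat \<Rightarrow> real \<Rightarrow> real \<Rightarrow> real" where
  "koornwinder \<alpha> \<beta> n k x y =
     poly (jacobi_poly (n - k) \<alpha> (\<beta> + real k + 1/2)) (2 * x - 1) *
     sqrt x ^ k * poly (jacobi_poly k \<beta> \<beta>) (y / sqrt x)"

definition koornwinder_quot :: "real \<Rightarrow> real \<Rightarrow> nat \<Rightarrow> nat \<Rightarrow> nat \<Rightarrow> real" where
  "koornwinder_quot \<alpha> \<beta> n k s =
     ((\<alpha> + \<beta> + 2 * real n - real k - 2 * real s - 1/2) *
        pochhammer (\<beta> + real n - real s + 1/2) (s + 1)) /
     (real (s + 1) * (\<alpha> + \<beta> + 2 * real n - real k - real s + 1/2) *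
        pochhammer (\<alpha> + \<beta> + real n - real s + 1/2) (s + 1))"

text \<open>
  For \<open>\<alpha>, \<beta> > -1\<close> and \<open>s < n - k\<close> the denominator vanishes only if \<open>k = 0\<close>, \<open>s = n - 1\<close> and
  \<open>\<alpha> + \<beta> = -3/2\<close>. There the numerator has the same linear factor \<open>\<alpha> + \<beta> + 3/2\<close>, and the quotient
  is to be read as its limit (HOL's \<open>0 / 0 = 0\<close> would be the wrong value).
\<close>

definition koornwinder_coeff :: "real \<Rightarrow> real \<Rightarrow> nat \<Rightarrow> nat \<Rightarrow> nat \<Rightarrow> real" where
  "koornwinder_coeff \<alpha> \<beta> n k s =
     (if pochhammer (\<alpha> + \<beta> + real n - real s + 1/2) (s + 1) = 0
      then Lim (at \<alpha>) (\<lambda>a. koornwinder_quot a \<beta> n k s)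
      else koornwinder_quot \<alpha> \<beta> n k s)"

end

theory Submission
  imports Defs
begin

text \<open>
  In the Koornwinder polynomial the parameter \<open>\<alpha>\<close> occurs only in the first Jacobi factor, so
  everything rests on the \<open>a\<close>-derivative of \<open>P\<^sub>n\<^sup>(\<^sup>a\<^sup>,\<^sup>b\<^sup>)(t)\<close>. Expand around \<open>t = -1\<close>, in powers of
  \<open>u = (1 + t) / 2\<close>. The coefficient of \<open>u\<^sup>k\<close> then depends on \<open>a\<close> only through
  \<open>(a + b + n + 1)\<^sub>k\<close>, so differentiating multiplies it by the harmonic sum
  \<open>\<Sum>i<k. 1 / (a + b + n + 1 + i)\<close>. Completing each of these sums to the range \<open>i < n\<close> produces the
  multiple of \<open>P\<^sub>n\<close> itself, and the claim becomes that the missing tails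
  \<open>\<Sum>k\<le>i<n. 1 / (a + b + n + 1 + i)\<close>, times the coefficients of \<open>P\<^sub>n\<close>, are combinations of the
  coefficients of the lower \<open>P\<^sub>j\<close> (\<open>jacobi_coeff_connection\<close>).

  In that identity every Pochhammer symbol of \<open>b\<close> alone cancels. With \<open>N = n - k\<close> and
  \<open>d = a + b + 2k + 1\<close> it reads
  \<open>\<Sum>l<N. 1 / (d + N + l) = \<Sum>l<N. (-1)\<^bsup>N-1-l\<^esup> (d + 2l) N! / ((N - l) (d + N + l) l! (d + l)\<^bsub>N-l\<^esub>)\<close>,
  an equation between rational functions of \<open>d\<close> that vanish at infinity, hence a comparison of
  residues (\<open>harmonic_alternating_sum\<close>): at \<open>d = -(N + l)\<close> only one term on the right has a pole, with
  residue 1; at \<open>d = -m\<close> with \<open>m < N\<close> the residues of the terms \<open>l\<close> and \<open>m - l\<close> are opposite.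

  For \<open>a + b > -2\<close> the only zero denominator occurs at \<open>a + b = -1\<close>, \<open>j = k = 0\<close>. There the
  factor \<open>a + b + 1\<close> of the term \<open>j = 0\<close> cancels against the Pochhammer symbol below it. Both sides are continuous in \<open>a + b\<close> once this is
  done, so the identity persists (\<open>harmonic_connection\<close>), and the cancelled value is the limit by
  which the coefficient of the theorem is defined there (\<open>koornwinder_coeff_eq_jacobi_conn\<close>).
\<close>

section \<open>Jacobi polynomials in powers of (1 + t) / 2\<close>

text \<open>
  The coefficient of \<open>((1 + t) / 2)\<^sup>i\<close> in the Jacobi polynomial. The binomial coefficient makes it
  vanish for \<open>i > n\<close>, so polynomials of different degrees can be summed over a common range.
\<close>

definition jacobi_coeff :: "nat \<Rightarrow> real \<Rightarrow> real \<Rightarrow> nat \<Rightarrow> real" where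
  "jacobi_coeff n a b i = (-1) ^ (n + i) * real (n choose i) / fact n *
     pochhammer (b + real i + 1) (n - i) * pochhammer (a + b + real n + 1) i"

text \<open>
  The coefficients, in powers of \<open>(1 + t) / 2\<close>, of the polynomial factor in the \<open>k\<close>-th
  derivative of \<open>(1 - t)\<^sup>c (1 + t)\<^sup>e\<close>, for exponents that do not change with \<open>k\<close>, as the induction on \<open>k\<close> requires. Rodrigues' formula is the case \<open>k = n\<close>,
  \<open>c = n + a\<close>, \<open>e = n + b\<close>.
\<close>

definition rodrigues_coeff :: "real \<Rightarrow> real \<Rightarrow> nat \<Rightarrow> nat \<Rightarrow> real" where
  "rodrigues_coeff c e k i = (-1) ^ i * real (k choose i) *
     pochhammer (e - real k + real i + 1) (k - i) * pochhammer (c + e - real k + 1) i"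

lemma rodrigues_coeff_Suc_0:
  "rodrigues_coeff c e (Suc k) 0 = (e - real k) * rodrigues_coeff c e k 0"
  by (simp add: rodrigues_coeff_def pochhammer_rec add_ac)

text \<open>
  All three terms share the factor \<open>(e - k + i + 1)\<^bsub>k-i\<^esub> (c + e - k + 1)\<^sub>i\<close>; what remains is Pascal's
  rule together with \<open>(i + 1) (k choose (i + 1)) = (k - i) (k choose i)\<close>.
\<close>

lemma rodrigues_coeff_Suc_Suc:
  "rodrigues_coeff c e (Suc k) (Suc i) =
     (e - real k + real (Suc i)) * rodrigues_coeff c e k (Suc i)
     - (c + e - 2 * real k + real i) * rodrigues_coeff c e k i"
proof (cases "i \<le> k")
  case False
  then show ?thesis by (simp add: rodrigues_coeff_def binomial_eq_0)
next
  case True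
  define s where "s = c + e - real k"
  define p where "p = pochhammer (e - real k + real i + 1) (k - i)"
  define q where "q = pochhammer (s + 1) i"
  have 1: "(e - real k + real (Suc i)) * rodrigues_coeff c e k (Suc i)
     = (-1) ^ Suc i * real (k choose Suc i) * p * q * (s + real (Suc i))"
  proof (cases "i = k")
    case True then show ?thesis by (simp add: rodrigues_coeff_def binomial_eq_0)
  next
    case False
    with True obtain r where r: "k - i = Suc r" "k - Suc i = r" by (metis Suc_diff_Suc le_neq_implies_less)
    have "p = (e - real k + real (Suc i)) * pochhammer (e - real k + real (Suc i) + 1) r"
      by (simp add: p_def r pochhammer_rec add_ac)
    moreover have "pochhammer (s + 1) (Suc i) = q * (s + real (Suc i))"
      by (simp add: q_def pochhammer_Suc add_ac)
    ultimately show ?thesis by (simp only: rodrigues_coeff_def r s_def mult_ac)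
  qed
  have 2: "rodrigues_coeff c e k i = (-1) ^ i * real (k choose i) * p * q"
    by (simp add: rodrigues_coeff_def p_def q_def s_def)
  have 3: "rodrigues_coeff c e (Suc k) (Suc i) = (-1) ^ Suc i * real (Suc k choose Suc i) * p * q * s"
    by (simp add: rodrigues_coeff_def p_def q_def s_def pochhammer_rec algebra_simps)
  have 4: "real (k choose Suc i) * real (Suc i) = real (k choose i) * (real k - real i)"
  proof -
    have "real ((k choose Suc i) * Suc i) = real ((k choose i) * (k - i))"
      by (metis binomial_absorb_comp binomial_absorption mult.commute)
    then show ?thesis using True by (simp only: of_nat_mult of_nat_diff)
  qed
  have "real (k choose Suc i) * (s + real (Suc i)) + real (k choose i) * (s - real k + real i)
      = real (Suc k choose Suc i) * s + (real (k choose Suc i) * real (Suc i) - real (k choose i) * (real k - real i))"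
    by (simp add: algebra_simps)
  then have 5: "real (Suc k choose Suc i) * s = real (k choose Suc i) * (s + real (Suc i)) + real (k choose i) * (s - real k + real i)"
    using 4 by simp
  have "rodrigues_coeff c e (Suc k) (Suc i) = (-1) ^ Suc i * p * q * (real (Suc k choose Suc i) * s)"
    unfolding 3 by (simp only: mult_ac)
  also have "\<dots> = (-1) ^ Suc i * real (k choose Suc i) * p * q * (s + real (Suc i)) - (s - real k + real i) * ((-1) ^ i * real (k choose i) * p * q)"
    unfolding 5 by (simp add: algebra_simps)
  finally show ?thesis unfolding 1 2 by (simp add: s_def algebra_simps)
qed

text \<open>
  The recursion of the coefficients in the form in which the product rule yields it: the last sum
  is the derivative of the polynomial with respect to \<open>u\<close>.
\<close>

lemma rodrigues_poly_Suc:
  "(\<Sum>i\<le>Suc k. rodrigues_coeff c e (Suc k) i * u ^ i) =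
     ((e - real k) - (c + e - 2 * real k) * u) * (\<Sum>i\<le>k. rodrigues_coeff c e k i * u ^ i)
     + u * (1 - u) * (\<Sum>i\<le>k. rodrigues_coeff c e k i * (real i * u ^ (i - 1)))"
proof -
  define q where "q = rodrigues_coeff c e k"
  have q0: "q (Suc k) = 0" by (simp add: q_def rodrigues_coeff_def)
  have der: "u * (\<Sum>i\<le>k. q i * (real i * u ^ (i - 1))) = (\<Sum>i\<le>k. real i * q i * u ^ i)"
    unfolding sum_distrib_left
  proof (rule sum.cong[OF refl])
    fix i show "u * (q i * (real i * u ^ (i - 1))) = real i * q i * u ^ i" by (cases i) auto
  qed
  have "(\<Sum>i\<le>Suc k. rodrigues_coeff c e (Suc k) i * u ^ i)
      = (e - real k) * q 0 + (\<Sum>i\<le>k. (e - real k + real (Suc i)) * q (Suc i) * u ^ Suc i - (c + e - 2 * real k + real i) * q i * u ^ Suc i)"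
    by (subst sum.atMost_Suc_shift) (simp only: rodrigues_coeff_Suc_0 rodrigues_coeff_Suc_Suc q_def left_diff_distrib power_0 mult_1_right)
  also have "\<dots> = (\<Sum>i\<le>Suc k. (e - real k + real i) * q i * u ^ i) - (\<Sum>i\<le>k. (c + e - 2 * real k + real i) * q i * u ^ Suc i)"
    by (subst sum.atMost_Suc_shift) (simp add: sum_subtractf)
  also have "(\<Sum>i\<le>Suc k. (e - real k + real i) * q i * u ^ i) = (\<Sum>i\<le>k. (e - real k + real i) * q i * u ^ i)"
    by (simp add: q0)
  also have "\<dots> - (\<Sum>i\<le>k. (c + e - 2 * real k + real i) * q i * u ^ Suc i)
      = ((e - real k) - (c + e - 2 * real k) * u) * (\<Sum>i\<le>k. q i * u ^ i) + (1 - u) * (\<Sum>i\<le>k. real i * q i * u ^ i)"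
    unfolding sum_distrib_left sum.distrib[symmetric] sum_subtractf[symmetric]
    by (rule sum.cong) (auto simp: algebra_simps)
  finally show ?thesis unfolding der[symmetric] q_def[symmetric] by (simp only: mult_ac)
qed

lemma higher_deriv_jacobi_weight:
  assumes "t \<in> {-1<..<1}"
  shows "(deriv ^^ k) (\<lambda>t. (1 - t) powr c * (1 + t) powr e) t =
    2 ^ k * (1 - t) powr (c - real k) * (1 + t) powr (e - real k) *
      (\<Sum>i\<le>k. rodrigues_coeff c e k i * ((1 + t) / 2) ^ i)"
  using assms
proof (induction k arbitrary: t)
  case 0
  then show ?case by (simp add: rodrigues_coeff_def)
next
  case (Suc k)
  define F where "F = (\<lambda>k t. 2 ^ k * (1 - t) powr (c - real k) * (1 + t) powr (e - real k) *
      (\<Sum>i\<le>k. rodrigues_coeff c e k i * ((1 + t) / 2) ^ i))"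
  define S where "S = (\<Sum>i\<le>k. rodrigues_coeff c e k i * ((1 + t) / 2) ^ i)"
  define S' where "S' = (\<Sum>i\<le>k. rodrigues_coeff c e k i * (real i * ((1 + t) / 2) ^ (i - 1)))"
  define X where "X = (1 - t) powr (c - real (Suc k))"
  define Y where "Y = (1 + t) powr (e - real (Suc k))"
  have t: "1 - t > 0" "1 + t > 0" using Suc.prems by auto
  have X: "(1 - t) powr (c - real k) = X * (1 - t)"
    using t powr_mult_base[of "1 - t" "c - real (Suc k)"] by (simp add: X_def mult_ac)
  have Y: "(1 + t) powr (e - real k) = Y * (1 + t)"
    using t powr_mult_base[of "1 + t" "e - real (Suc k)"] by (simp add: Y_def mult_ac)
  have dX: "((\<lambda>t. (1 - t) powr (c - real k)) has_real_derivative - ((c - real k) * X)) (at t)"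
    using t by (auto intro!: derivative_eq_intros simp: X_def algebra_simps)
  have dY: "((\<lambda>t. (1 + t) powr (e - real k)) has_real_derivative (e - real k) * Y) (at t)"
    using t by (auto intro!: derivative_eq_intros simp: Y_def algebra_simps)
  have dS: "((\<lambda>t. \<Sum>i\<le>k. rodrigues_coeff c e k i * ((1 + t) / 2) ^ i) has_real_derivative S' / 2) (at t)"
    by (auto intro!: derivative_eq_intros sum.cong simp: S'_def sum_divide_distrib)
  have dF: "(F k has_real_derivative 2 ^ k * (- ((c - real k) * X) * (Y * (1 + t)) * S + X * (1 - t) * ((e - real k) * Y) * S
     + X * (1 - t) * (Y * (1 + t)) * (S' / 2))) (at t)"
    unfolding F_def by (rule derivative_eq_intros dX dY dS refl)+ (simp add: X Y S_def algebra_simps)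
  have "eventually (\<lambda>s. s \<in> {-1<..<1}) (nhds t)"
    using Suc.prems by (intro eventually_nhds_in_open) auto
  then have ev: "eventually (\<lambda>s. (deriv ^^ k) (\<lambda>t. (1 - t) powr c * (1 + t) powr e) s = F k s) (nhds t)"
    by eventually_elim (simp add: Suc.IH F_def)
  have "(deriv ^^ Suc k) (\<lambda>t. (1 - t) powr c * (1 + t) powr e) t = deriv (F k) t"
    using deriv_cong_ev[OF ev refl] by simp
  also have "\<dots> = 2 ^ k * (- ((c - real k) * X) * (Y * (1 + t)) * S + X * (1 - t) * ((e - real k) * Y) * S
     + X * (1 - t) * (Y * (1 + t)) * (S' / 2))"
    by (rule DERIV_imp_deriv[OF dF])
  also have "\<dots> = 2 ^ Suc k * X * Y * (((e - real k) - (c + e - 2 * real k) * ((1 + t) / 2)) * S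
       + (1 + t) / 2 * (1 - (1 + t) / 2) * S')"
    by (simp add: field_simps)
  finally show ?case unfolding rodrigues_poly_Suc S_def S'_def X_def Y_def .
qed

text \<open>
  The powers in Rodrigues' formula cancel on the open interval, and a polynomial is determined by its
  values on an infinite set; this identifies the polynomial picked by the definite description.
\<close>

lemma poly_jacobi_poly:
  "poly (jacobi_poly n a b) t = (\<Sum>i\<le>n. jacobi_coeff n a b i * ((1 + t) / 2) ^ i)"
proof -
  define p where "p = (\<Sum>i\<le>n. smult (jacobi_coeff n a b i) ([:1/2, 1/2:] ^ i))"
  have p: "poly p t = (\<Sum>i\<le>n. jacobi_coeff n a b i * ((1 + t) / 2) ^ i)" for t
    by (simp add: p_def poly_sum poly_power add_divide_distrib)
  have agree: "poly p t = jacobi_rodrigues n a b t" if t: "t \<in> {-1<..<1}" for t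
  proof -
    have w: "(1 - t) powr (- a) * (1 - t) powr a = 1" "(1 + t) powr (- b) * (1 + t) powr b = 1"
      using t by (simp_all add: powr_add[symmetric])
    have "jacobi_rodrigues n a b t = (-1) ^ n / fact n * ((1 - t) powr (- a) * (1 - t) powr a) * ((1 + t) powr (- b) * (1 + t) powr b)
        * (\<Sum>i\<le>n. rodrigues_coeff (real n + a) (real n + b) n i * ((1 + t) / 2) ^ i)"
      unfolding jacobi_rodrigues_def higher_deriv_jacobi_weight[OF t] by simp
    then have "jacobi_rodrigues n a b t = (-1) ^ n / fact n * (\<Sum>i\<le>n. rodrigues_coeff (real n + a) (real n + b) n i * ((1 + t) / 2) ^ i)"
      unfolding w by simp
    also have "\<dots> = poly p t"
      unfolding p sum_distrib_left
      by (intro sum.cong refl) (simp add: jacobi_coeff_def rodrigues_coeff_def power_add algebra_simps)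
    finally show ?thesis by simp
  qed
  have "jacobi_poly n a b = p"
    unfolding jacobi_poly_def
  proof (rule the_equality)
    show "\<forall>x\<in>{-1<..<1}. poly p x = jacobi_rodrigues n a b x" using agree by blast
  next
    fix r assume r: "\<forall>x\<in>{-1<..<1}. poly r x = jacobi_rodrigues n a b x"
    have "{-1<..<1} \<subseteq> {x. poly (r - p) x = 0}" using r agree by auto
    moreover have "infinite {-1<..<(1::real)}" by simp
    ultimately have "infinite {x. poly (r - p) x = 0}" using finite_subset by blast
    then have "r - p = 0" using poly_roots_finite by blast
    then show "r = p" by simp
  qed
  then show ?thesis by (simp add: p)
qed

section \<open>A harmonic sum as an alternating sum\<close>

text \<open>
  Induction works because \<open>(p + 1) / (z)\<^bsub>p+2\<^esub> = 1 / (z)\<^bsub>p+1\<^esub> - 1 / (z + 1)\<^bsub>p+1\<^esub>\<close>: the two products on the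
  right share all factors but the first and the last.
\<close>

lemma inverse_pochhammer_partial_fractions:
  fixes z :: real
  assumes "\<And>i. i \<le> p \<Longrightarrow> z + real i \<noteq> 0"
  shows "1 / pochhammer z (Suc p) =
    (\<Sum>m\<le>p. (-1) ^ m / (fact m * fact (p - m) * (z + real m)))"
  using assms
proof (induction p arbitrary: z)
  case 0
  then show ?case by simp
next
  case (Suc p)
  define f where "f = (\<lambda>m. (-1) ^ m / (fact m * fact (Suc p - m) * (z + real m)) :: real)"
  have nz: "z + real i \<noteq> 0" if "i \<le> Suc p" for i using Suc.prems that by blast
  have z0: "z \<noteq> 0" using nz[of 0] by simp
  have p1: "pochhammer z (Suc p) \<noteq> 0"
    using nz by (auto simp: pochhammer_eq_0_iff) (metis less_imp_le)
  have zl: "z + real (Suc p) \<noteq> 0" using nz[of "Suc p"] by simp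
  define B where "B = pochhammer (z+1) p"
  have e1: "pochhammer z (Suc p) = z * B" by (simp add: B_def pochhammer_rec)
  have e2: "pochhammer (z+1) (Suc p) = B * (z + real (Suc p))" by (simp add: B_def pochhammer_Suc algebra_simps)
  have e3: "pochhammer z (Suc (Suc p)) = z * B * (z + real (Suc p))"
    by (subst pochhammer_Suc) (simp add: e1)
  have B0: "B \<noteq> 0" using p1 e1 by auto
  have i1: "1 / pochhammer z (Suc p) = (\<Sum>m\<le>p. (-1) ^ m / (fact m * fact (p - m) * (z + real m)))"
    by (rule Suc.IH) (use nz in auto)
  have i2: "1 / pochhammer (z+1) (Suc p) = (\<Sum>m\<le>p. (-1) ^ m / (fact m * fact (p - m) * (z + 1 + real m)))"
    by (rule Suc.IH) (use nz[OF Suc_le_mono[THEN iffD2]] in \<open>auto simp: algebra_simps\<close>)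
  have "real (Suc p) * (1 / pochhammer z (Suc (Suc p))) = 1 / pochhammer z (Suc p) - 1 / pochhammer (z+1) (Suc p)"
    unfolding e1 e2 e3 using z0 B0 zl by (simp add: divide_simps)
  also have "1 / pochhammer z (Suc p) = (\<Sum>m\<le>p. real (Suc p - m) * f m)"
    unfolding i1 by (rule sum.cong) (auto simp: f_def Suc_diff_le divide_simps)
  also have "\<dots> = (\<Sum>m\<le>Suc p. real (Suc p - m) * f m)" by simp
  also have "1 / pochhammer (z+1) (Suc p) = - (\<Sum>m\<le>p. real (Suc m) * f (Suc m))"
    unfolding i2 sum_negf[symmetric]
    by (rule sum.cong) (auto simp: f_def divide_simps add_ac)
  also have "(\<Sum>m\<le>p. real (Suc m) * f (Suc m)) = (\<Sum>m\<le>Suc p. real m * f m)"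
    by (subst sum.atMost_Suc_shift) simp
  also have "(\<Sum>m\<le>Suc p. real (Suc p - m) * f m) - - (\<Sum>m\<le>Suc p. real m * f m) = (\<Sum>m\<le>Suc p. real (Suc p) * f m)"
    unfolding diff_minus_eq_add sum.distrib[symmetric]
    by (rule sum.cong) (auto simp: of_nat_diff algebra_simps)
  also have "\<dots> = real (Suc p) * (\<Sum>m\<le>Suc p. f m)" by (simp only: sum_distrib_left)
  finally show ?case
    unfolding f_def by (subst (asm) mult_left_cancel) auto
qed

lemma antisymmetric_sum_zero:
  fixes f :: "nat \<Rightarrow> real"
  assumes "\<And>l. l \<le> m \<Longrightarrow> f (m - l) = - f l"
  shows "(\<Sum>l\<le>m. f l) = 0"
proof -
  have "(\<Sum>l\<le>m. f l) = (\<Sum>l\<le>m. f (m - l))" by (rule sum.nat_diff_reindex[symmetric, of f "Suc m", simplified lessThan_Suc_atMost diff_Suc_Suc])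
  also have "\<dots> = - (\<Sum>l\<le>m. f l)" using assms by (simp add: sum_negf)
  finally show ?thesis by simp
qed

text \<open>
  The residue comparison, carried out by expanding each inverse Pochhammer symbol on the left into
  partial fractions and collecting the terms with denominator \<open>d + m\<close>, for \<open>m < N\<close>, and
  \<open>d + N + l\<close>.
\<close>

lemma harmonic_alternating_sum:
  fixes d :: real
  assumes nz: "\<And>i. i < 2 * N \<Longrightarrow> d + real i \<noteq> 0"
  shows "(\<Sum>l<N. (-1) ^ (N - 1 - l) * (d + 2 * real l) * fact N /
            (real (N - l) * (d + real N + real l) * fact l * pochhammer (d + real l) (N - l)))
       = (\<Sum>l<N. 1 / (d + real N + real l))"
proof -
  \<comment> \<open>In the summand with index \<open>l\<close>, the residue at \<open>d = -m\<close> is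
    \<open>A m l * (2 * l - m)\<close>, and \<open>A m l * (N - l)\<close> is the share of the pole at \<open>-m\<close> in the
    residue at \<open>d = -(N + l)\<close>.\<close>
  define A where "A = (\<lambda>m l. (-1) ^ (N - 1 + m) * fact N / (fact l * fact (m - l) * fact (N - 1 - m)
     * real (N - l) * real (N + l - m)) :: real)"
  have summand: "(-1) ^ (N - 1 - l) * (d + 2 * real l) * fact N /
            (real (N - l) * (d + real N + real l) * fact l * pochhammer (d + real l) (N - l))
     = (\<Sum>m\<in>{l..<N}. A m l * (2 * real l - real m) / (d + real m) + A m l * real (N - l) / (d + real N + real l))"
    if l: "l < N" for l
  proof -
    define p where "p = N - 1 - l"
    have Np: "N = l + Suc p" using l by (simp add: p_def)
    have dN: "d + real N + real l \<noteq> 0" using nz[of "N + l"] l by (simp add: add_ac)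
    have "1 / pochhammer (d + real l) (Suc p) = (\<Sum>m\<le>p. (-1) ^ m / (fact m * fact (p - m) * (d + real l + real m)))"
      by (rule inverse_pochhammer_partial_fractions) (use nz Np in \<open>metis add.assoc of_nat_add add_less_mono le_imp_less_Suc add_strict_left_mono mult_2 trans_less_add1 \<close>)
    also have "\<dots> = (\<Sum>m\<in>{l..<N}. (-1) ^ (m-l) / (fact (m-l) * fact (N - 1 - m) * (d + real m)))"
      by (rule sum.reindex_bij_witness[of _ "\<lambda>m. m - l" "\<lambda>m. m + l"]) (auto simp: Np add_ac)
    finally have pf: "1 / pochhammer (d + real l) (N - l) = (\<Sum>m\<in>{l..<N}. (-1) ^ (m-l) / (fact (m-l) * fact (N - 1 - m) * (d + real m)))"
      by (simp add: Np)
    have "(-1) ^ (N - 1 - l) * (d + 2 * real l) * fact N /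
            (real (N - l) * (d + real N + real l) * fact l * pochhammer (d + real l) (N - l))
       = (-1) ^ (N - 1 - l) * (d + 2 * real l) * fact N / (real (N - l) * (d + real N + real l) * fact l) * (1 / pochhammer (d + real l) (N - l))"
      by simp
    also have "\<dots> = (\<Sum>m\<in>{l..<N}. A m l * (2 * real l - real m) / (d + real m) + A m l * real (N - l) / (d + real N + real l))"
      unfolding pf sum_distrib_left
    proof (rule sum.cong[OF refl])
      fix m assume m: "m \<in> {l..<N}"
      have dm: "d + real m \<noteq> 0" using nz[of m] m by simp
      have nl: "real (N - l) \<noteq> 0" using l by simp
      have nm: "real (N + l - m) \<noteq> 0" using m by simp
      have sg: "(-1) ^ (N - 1 - l) * (-1) ^ (m - l) = ((-1) ^ (N - 1 + m) :: real)"
      proof -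
        have "N - 1 + m = (N - 1 - l) + (m - l) + 2 * l" using m by auto
        then show ?thesis by (simp only: power_add power_mult) simp
      qed
      have key: "(2 * real l - real m) / (d + real m) + real (N - l) / (d + real N + real l)
          = real (N + l - m) * (d + 2 * real l) / ((d + real m) * (d + real N + real l))"
        using dm dN m by (simp add: divide_simps of_nat_diff) (simp add: algebra_simps)
      have "A m l * (2 * real l - real m) / (d + real m) + A m l * real (N - l) / (d + real N + real l)
         = A m l * (real (N + l - m) * (d + 2 * real l) / ((d + real m) * (d + real N + real l)))"
        unfolding key[symmetric] by (simp add: distrib_left)
      also have "\<dots> = ((-1) ^ (N - 1 - l) * (-1) ^ (m - l)) * (d + 2 * real l) * fact N / (real (N - l) * (d + real N + real l) * fact l) / (fact (m-l) * fact (N - 1 - m) * (d + real m))"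
        unfolding A_def sg using nm by (simp add: mult_ac)
      finally show "(-1) ^ (N - 1 - l) * (d + 2 * real l) * fact N / (real (N - l) * (d + real N + real l) * fact l) * ((-1) ^ (m-l) / (fact (m-l) * fact (N - 1 - m) * (d + real m))) = A m l * (2 * real l - real m) / (d + real m) + A m l * real (N - l) / (d + real N + real l)"
        by (simp add: mult_ac)
    qed
    finally show ?thesis .
  qed
  \<comment> \<open>\<open>A m l\<close> is invariant under \<open>l \<mapsto> m - l\<close>, and \<open>2 * l - m\<close> changes sign.\<close>
  have res0: "(\<Sum>l\<le>m. A m l * (2 * real l - real m) / (d + real m)) = 0" if "m < N" for m
    by (rule antisymmetric_sum_zero) (use that in \<open>auto simp: A_def of_nat_diff divide_simps, simp add: algebra_simps\<close>)
  \<comment> \<open>The sum is again a partial fraction expansion, evaluated at \<open>z = -N\<close>.\<close>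
  have res1: "(\<Sum>m\<in>{l..<N}. A m l * real (N - l)) = 1" if l: "l < N" for l
  proof -
    define p where "p = N - 1 - l"
    have Np: "N = l + Suc p" using l by (simp add: p_def)
    have "1 / pochhammer (- real N) (Suc p) = (\<Sum>m\<le>p. (-1) ^ m / (fact m * fact (p - m) * (- real N + real m)))"
      by (rule inverse_pochhammer_partial_fractions) (use Np in auto)
    also have "\<dots> = - (\<Sum>m\<in>{l..<N}. (-1) ^ (m-l) / (fact (m-l) * fact (N - 1 - m) * real (N + l - m)))"
      unfolding sum_negf[symmetric]
      by (rule sum.reindex_bij_witness[of _ "\<lambda>m. m - l" "\<lambda>m. m + l"])
        (auto simp: Np of_nat_diff divide_simps, simp add: algebra_simps)
    finally have pf: "(\<Sum>m\<in>{l..<N}. (-1) ^ (m-l) / (fact (m-l) * fact (N - 1 - m) * real (N + l - m))) = - 1 / pochhammer (- real N) (Suc p)" by simp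
    have "(\<Sum>m\<in>{l..<N}. A m l * real (N - l)) = (-1)^(N - 1 + l) * fact N / fact l * (\<Sum>m\<in>{l..<N}. (-1) ^ (m-l) / (fact (m-l) * fact (N - 1 - m) * real (N + l - m)))"
      unfolding sum_distrib_left
    proof (rule sum.cong[OF refl])
      fix m assume m: "m \<in> {l..<N}"
      have sg: "(-1) ^ (N - 1 + m) = (-1) ^ (N - 1 + l) * ((-1) ^ (m - l) :: real)"
        using m by (simp add: power_add[symmetric])
      show "A m l * real (N - l) = (-1)^(N - 1 + l) * fact N / fact l * ((-1) ^ (m-l) / (fact (m-l) * fact (N - 1 - m) * real (N + l - m)))"
        unfolding A_def sg using l by (simp add: mult_ac)
    qed
    also have "\<dots> = 1"
    proof -
      have "fact N = (fact l :: real) * pochhammer (real l + 1) (Suc p)"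
        unfolding Np pochhammer_fact by (subst pochhammer_product') (simp add: add.commute)
      then have "pochhammer (- real N) (Suc p) = (-1) ^ (Suc p) * fact N / fact l"
        unfolding pochhammer_minus by (simp add: Np)
      moreover have "(-1) ^ (N - 1 + l) = ((-1) ^ p :: real)"
      proof -
        have "N - 1 + l = p + 2 * l" by (simp add: Np)
        then show ?thesis by (simp only: power_add power_mult) simp
      qed
      ultimately show ?thesis unfolding pf by simp
    qed
    finally show ?thesis .
  qed
  have "(\<Sum>l<N. (-1) ^ (N - 1 - l) * (d + 2 * real l) * fact N /
            (real (N - l) * (d + real N + real l) * fact l * pochhammer (d + real l) (N - l)))
      = (\<Sum>l<N. \<Sum>m\<in>{l..<N}. A m l * (2 * real l - real m) / (d + real m))
        + (\<Sum>l<N. \<Sum>m\<in>{l..<N}. A m l * real (N - l) / (d + real N + real l))"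
    unfolding sum.distrib[symmetric] by (intro sum.cong[OF refl] summand) simp
  also have "(\<Sum>l<N. \<Sum>m\<in>{l..<N}. A m l * (2 * real l - real m) / (d + real m))
      = (\<Sum>m<N. \<Sum>l\<le>m. A m l * (2 * real l - real m) / (d + real m))"
  proof -
    have "(\<Sum>l<N. \<Sum>m\<in>{l..<N}. A m l * (2 * real l - real m) / (d + real m))
      = (\<Sum>l<N. \<Sum>m | m \<in> {..<N} \<and> l \<le> m. A m l * (2 * real l - real m) / (d + real m))"
      by (intro sum.cong) auto
    also have "\<dots> = (\<Sum>m<N. \<Sum>l | l \<in> {..<N} \<and> l \<le> m. A m l * (2 * real l - real m) / (d + real m))"
      by (rule sum.swap_restrict) auto
    also have "\<dots> = (\<Sum>m<N. \<Sum>l\<le>m. A m l * (2 * real l - real m) / (d + real m))"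
      by (intro sum.cong) auto
    finally show ?thesis .
  qed
  also have "\<dots> = 0" by (intro sum.neutral ballI res0) simp
  also have "(\<Sum>l<N. \<Sum>m\<in>{l..<N}. A m l * real (N - l) / (d + real N + real l)) = (\<Sum>l<N. 1 / (d + real N + real l))"
    unfolding sum_divide_distrib[symmetric] by (intro sum.cong[OF refl]) (simp only: res1 lessThan_iff)
  finally show ?thesis by simp
qed

section \<open>Differentiation of Jacobi polynomials with respect to the first parameter\<close>

text \<open>
  This is \<open>(c + 1 + 2j) / (c + j + 1)\<^bsub>n-j\<^esub>\<close>. For \<open>j = 0\<close> the factor \<open>c + 1\<close> is cancelled, which removes
  the singularity at \<open>c = -1\<close> and leaves a continuous function on \<open>c > -2\<close>.
\<close>

definition conn_weight :: "real \<Rightarrow> nat \<Rightarrow> nat \<Rightarrow> real" where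
  "conn_weight c n j = (if j = 0 then 1 / pochhammer (c + 2) (n - 1)
     else (c + 1 + 2 * real j) / pochhammer (c + real j + 1) (n - j))"

text \<open>
  The coefficient of \<open>P\<^sub>j\<close> in the \<open>a\<close>-derivative of \<open>P\<^sub>n\<close>, for \<open>j < n\<close>.
\<close>

definition jacobi_conn :: "real \<Rightarrow> real \<Rightarrow> nat \<Rightarrow> nat \<Rightarrow> real" where
  "jacobi_conn a b n j = conn_weight (a + b) n j * pochhammer (b + real j + 1) (n - j) /
     (real (n - j) * (a + b + 1 + real n + real j))"

lemma conn_weight_eq:
  assumes "j < n" "c + real j + 1 \<noteq> 0"
  shows "conn_weight c n j = (c + 1 + 2 * real j) / pochhammer (c + real j + 1) (n - j)"
proof (cases "j = 0")
  case True
  obtain r where "n = Suc r" using assms by (cases n) auto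
  then show ?thesis using True assms by (simp add: conn_weight_def pochhammer_rec add_ac)
qed (simp add: conn_weight_def)

lemma isCont_conn_weight:
  assumes "c > -2"
  shows "isCont (\<lambda>c. conn_weight c n j) c"
proof (cases "j = 0")
  case True
  have "pochhammer (c + 2) (n - 1) > 0" using assms by (intro pochhammer_pos) auto
  moreover have "isCont (\<lambda>c. pochhammer (c + 2) (n - 1)) c"
    by (rule isCont_o2[of c "\<lambda>c. c + 2"]) (auto intro!: continuous_intros)
  ultimately show ?thesis using True by (auto simp: conn_weight_def intro!: continuous_intros)
next
  case False
  have "pochhammer (c + real j + 1) (n - j) > 0" using assms False by (intro pochhammer_pos) auto
  moreover have "isCont (\<lambda>c. pochhammer (c + real j + 1) (n - j)) c"
    by (rule isCont_o2[of c "\<lambda>c. c + real j + 1"]) (auto intro!: continuous_intros)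
  ultimately show ?thesis using False by (auto simp: conn_weight_def intro!: continuous_intros)
qed

text \<open>
  The sum of \<open>harmonic_alternating_sum\<close> for \<open>N = n - k\<close> and \<open>d = c + 2k + 1\<close>, indexed by
  \<open>j = k + l\<close>. The Pochhammer symbols match because \<open>(c + j + 1)\<^bsub>n-j+k\<^esub>\<close> can be split after its first
  \<open>k\<close> or after its first \<open>n - j\<close> factors.
\<close>

lemma harmonic_connection_generic:
  assumes "k < n" "c > -2" "c \<noteq> -1"
  shows "(\<Sum>i\<in>{k..<n}. 1 / (c + real n + 1 + real i)) * pochhammer (c + real n + 1) k / fact (n - k) =
    (\<Sum>j\<in>{k..<n}. (-1) ^ (n - 1 - j) * conn_weight c n j * pochhammer (c + real j + 1) k /
        (real (n - j) * (c + 1 + real n + real j) * fact (j - k)))"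
proof -
  define N where "N = n - k"
  define d where "d = c + 2 * real k + 1"
  have n: "n = N + k" using assms by (simp add: N_def)
  have nz: "c + real i + 1 \<noteq> 0" for i using assms by (cases i) auto
  have nz': "d + real i \<noteq> 0" for i using nz[of "i + 2 * k"] by (simp add: d_def add_ac)
  have "(\<Sum>i\<in>{k..<n}. 1 / (c + real n + 1 + real i)) = (\<Sum>l<N. 1 / (d + real N + real l))"
    by (rule sum.reindex_bij_witness[of _ "\<lambda>l. l + k" "\<lambda>i. i - k"]) (auto simp: n d_def of_nat_diff)
  also have "\<dots> = (\<Sum>l<N. (-1) ^ (N - 1 - l) * (d + 2 * real l) * fact N /
            (real (N - l) * (d + real N + real l) * fact l * pochhammer (d + real l) (N - l)))"
    by (rule harmonic_alternating_sum[symmetric]) (rule nz')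
  finally have harmonic: "(\<Sum>i\<in>{k..<n}. 1 / (c + real n + 1 + real i)) = (\<Sum>l<N. (-1) ^ (N - 1 - l) * (d + 2 * real l) * fact N /
            (real (N - l) * (d + real N + real l) * fact l * pochhammer (d + real l) (N - l)))" .
  have "(\<Sum>i\<in>{k..<n}. 1 / (c + real n + 1 + real i)) * pochhammer (c + real n + 1) k / fact (n - k)
    = (\<Sum>l<N. (-1) ^ (N - 1 - l) * (d + 2 * real l) * fact N /
            (real (N - l) * (d + real N + real l) * fact l * pochhammer (d + real l) (N - l)) * (pochhammer (c + real n + 1) k / fact N))"
    unfolding sum_distrib_right[symmetric] harmonic N_def[symmetric] by simp
  also have "\<dots> = (\<Sum>j\<in>{k..<n}. (-1) ^ (n - 1 - j) * conn_weight c n j * pochhammer (c + real j + 1) k /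
        (real (n - j) * (c + 1 + real n + real j) * fact (j - k)))"
  proof (rule sum.reindex_bij_witness[of _ "\<lambda>i. i - k" "\<lambda>l. l + k"])
    fix l assume "l \<in> {..<N}"
    then have l: "l < N" by simp
    define j where "j = l + k"
    have P1: "pochhammer (c + real j + 1) (k + (N - l)) = pochhammer (c + real j + 1) k * pochhammer (d + real l) (N - l)"
      by (subst pochhammer_product') (simp add: j_def d_def add_ac)
    have P2: "pochhammer (c + real j + 1) ((N - l) + k) = pochhammer (c + real j + 1) (N - l) * pochhammer (c + real n + 1) k"
      using l by (subst pochhammer_product') (simp add: j_def n of_nat_diff add_ac)
    have P: "pochhammer (c + real j + 1) k * pochhammer (d + real l) (N - l) = pochhammer (c + real j + 1) (N - l) * pochhammer (c + real n + 1) k"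
      using P1 P2 by (simp add: add.commute)
    have z1: "pochhammer (d + real l) (N - l) \<noteq> 0"
      unfolding pochhammer_eq_0_iff
    proof
      assume "\<exists>i<N - l. d + real l = - real i"
      then obtain i where "d + real l = - real i" by blast
      then show False using nz'[of "l + i"] by simp
    qed
    have z2: "pochhammer (c + real j + 1) (N - l) \<noteq> 0"
      unfolding pochhammer_eq_0_iff
    proof
      assume "\<exists>i<N - l. c + real j + 1 = - real i"
      then obtain i where "c + real j + 1 = - real i" by blast
      then show False using nz[of "j + i"] by simp
    qed
    have w: "conn_weight c n j = (d + 2 * real l) / pochhammer (c + real j + 1) (N - l)"
      using l nz[of "l + k"] by (subst conn_weight_eq) (auto simp: n j_def d_def algebra_simps)
    have P': "pochhammer (c + real j + 1) k / pochhammer (c + real j + 1) (N - l) = pochhammer (c + real n + 1) k / pochhammer (d + real l) (N - l)"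
      using P z1 z2 by (simp add: frac_eq_eq mult_ac)
    have "(-1) ^ (n - 1 - j) * conn_weight c n j * pochhammer (c + real j + 1) k /
        (real (n - j) * (c + 1 + real n + real j) * fact (j - k))
      = (-1) ^ (N - 1 - l) * (d + 2 * real l) * (pochhammer (c + real j + 1) k / pochhammer (c + real j + 1) (N - l)) / (real (N - l) * (d + real N + real l) * fact l)"
      unfolding w by (simp add: n j_def d_def add_ac)
    then show "(-1) ^ (n - 1 - (l + k)) * conn_weight c n (l + k) * pochhammer (c + real (l + k) + 1) k /
        (real (n - (l + k)) * (c + 1 + real n + real (l + k)) * fact (l + k - k)) =
        (-1) ^ (N - 1 - l) * (d + 2 * real l) * fact N /
            (real (N - l) * (d + real N + real l) * fact l * pochhammer (d + real l) (N - l)) * (pochhammer (c + real n + 1) k / fact N)"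
      unfolding j_def[symmetric] P' by (simp add: mult_ac)
  qed (auto simp: n)
  finally show ?thesis .
qed

text \<open>
  At \<open>c = -1\<close> both sides are continuous, and they agree in a punctured neighbourhood.
\<close>

lemma harmonic_connection:
  assumes "k < n" "c > -2"
  shows "(\<Sum>i\<in>{k..<n}. 1 / (c + real n + 1 + real i)) * pochhammer (c + real n + 1) k / fact (n - k) =
    (\<Sum>j\<in>{k..<n}. (-1) ^ (n - 1 - j) * conn_weight c n j * pochhammer (c + real j + 1) k /
        (real (n - j) * (c + 1 + real n + real j) * fact (j - k)))"
    (is "?L c = ?R c")
proof (cases "c = -1")
  case False
  then show ?thesis using harmonic_connection_generic assms by blast
next
  case True
  have poch: "isCont (\<lambda>c. pochhammer (c + real m + 1) k) c" for m :: nat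
    by (rule isCont_o2[of c "\<lambda>c. c + real m + 1"]) (auto intro!: continuous_intros)
  have "isCont (\<lambda>c. ?L c - ?R c) c"
    using assms by (intro continuous_intros poch isCont_conn_weight) auto
  then have "((\<lambda>c. ?L c - ?R c) \<longlongrightarrow> ?L c - ?R c) (at c)"
    by (simp add: isCont_def)
  moreover have "eventually (\<lambda>c. ?L c - ?R c = 0) (at c)"
  proof -
    have "eventually (\<lambda>x. x \<in> {-2<..}) (at c)"
      using assms by (intro eventually_at_in_open') auto
    moreover have "eventually (\<lambda>x. x \<noteq> c) (at c)" by (simp add: eventually_at_filter)
    ultimately show ?thesis
      by eventually_elim (use harmonic_connection_generic[OF assms(1)] True in auto)
  qed
  ultimately have "?L c - ?R c = 0"
    using tendsto_unique[OF at_neq_bot _ tendsto_eventually] by blast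
  then show ?thesis by simp
qed

text \<open>
  The dependence on \<open>b\<close> alone cancels because \<open>(b + k + 1)\<^bsub>j-k\<^esub> (b + j + 1)\<^bsub>n-j\<^esub> = (b + k + 1)\<^bsub>n-k\<^esub>\<close> for
  every \<open>j\<close>, which reduces the identity to \<open>harmonic_connection\<close>.
\<close>

lemma jacobi_coeff_connection:
  assumes "a + b > -2" "k \<le> n"
  shows "jacobi_coeff n a b k * (\<Sum>i\<in>{k..<n}. 1 / (a + b + real n + 1 + real i)) =
    - (\<Sum>j<n. jacobi_conn a b n j * jacobi_coeff j a b k)"
proof (cases "k = n")
  case True
  then show ?thesis by (simp add: jacobi_coeff_def binomial_eq_0)
next
  case False
  with assms have k: "k < n" by simp
  define c where "c = a + b"
  define B where "B = pochhammer (b + real k + 1) (n - k)"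
  have jc: "jacobi_coeff m a b k = (-1) ^ (m + k) / (fact k * fact (m - k)) * pochhammer (b + real k + 1) (m - k) * pochhammer (c + real m + 1) k"
    if "k \<le> m" for m using that by (simp add: jacobi_coeff_def binomial_fact c_def)
  have "jacobi_coeff n a b k * (\<Sum>i\<in>{k..<n}. 1 / (a + b + real n + 1 + real i))
    = (-1) ^ (n + k) / fact k * B * ((\<Sum>i\<in>{k..<n}. 1 / (c + real n + 1 + real i)) * pochhammer (c + real n + 1) k / fact (n - k))"
    using k by (simp add: jc B_def c_def[symmetric])
  also have "\<dots> = (\<Sum>j\<in>{k..<n}. (-1) ^ (n + k) / fact k * B * ((-1) ^ (n - 1 - j) * conn_weight c n j * pochhammer (c + real j + 1) k /
        (real (n - j) * (c + 1 + real n + real j) * fact (j - k))))"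
    unfolding sum_distrib_left[symmetric]
    by (subst harmonic_connection) (use k assms in \<open>auto simp: c_def\<close>)
  also have "\<dots> = (\<Sum>j\<in>{k..<n}. - (jacobi_conn a b n j * jacobi_coeff j a b k))"
  proof (rule sum.cong[OF refl])
    fix j assume j: "j \<in> {k..<n}"
    have B: "B = pochhammer (b + real k + 1) (j - k) * pochhammer (b + real j + 1) (n - j)"
      using pochhammer_product'[of "b + real k + 1" "j - k" "n - j"] j
      by (simp add: B_def of_nat_diff add_ac)
    have "(n + k) + (n - 1 - j) + 1 = (j + k) + 2 * (n - j)" using j by auto
    then have "(-1) ^ ((n + k) + (n - 1 - j) + 1) = ((-1) ^ ((j + k) + 2 * (n - j)) :: real)" by (rule arg_cong)
    then have sg: "(-1) ^ (n + k) * (-1) ^ (n - 1 - j) = - ((-1) ^ (j + k) :: real)"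
      by (simp only: power_add[of _ _ "2 * _"] power_mult) (simp add: power_add)
    have "(-1) ^ (n + k) / fact k * B * ((-1) ^ (n - 1 - j) * conn_weight c n j * pochhammer (c + real j + 1) k /
        (real (n - j) * (c + 1 + real n + real j) * fact (j - k)))
       = ((-1) ^ (n + k) * (-1) ^ (n - 1 - j)) / fact k * B * (conn_weight c n j * pochhammer (c + real j + 1) k /
        (real (n - j) * (c + 1 + real n + real j) * fact (j - k)))"
      by simp
    also have "\<dots> = - (jacobi_conn a b n j * jacobi_coeff j a b k)"
      unfolding sg B using j by (simp add: jc jacobi_conn_def c_def mult_ac)
    finally show "(-1) ^ (n + k) / fact k * B * ((-1) ^ (n - 1 - j) * conn_weight c n j * pochhammer (c + real j + 1) k /
        (real (n - j) * (c + 1 + real n + real j) * fact (j - k))) = - (jacobi_conn a b n j * jacobi_coeff j a b k)" .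
  qed
  also have "\<dots> = (\<Sum>j<n. - (jacobi_conn a b n j * jacobi_coeff j a b k))"
    by (rule sum.mono_neutral_left) (auto simp: jacobi_coeff_def binomial_eq_0)
  finally show ?thesis by (simp add: sum_negf)
qed

lemma DERIV_pochhammer:
  assumes "\<And>i. i < n \<Longrightarrow> z + real i \<noteq> 0"
  shows "((\<lambda>z. pochhammer z n) has_real_derivative pochhammer z n * (\<Sum>i<n. 1 / (z + real i))) (at z)"
  using assms
proof (induction n)
  case (Suc n)
  have "((\<lambda>z. z + real n) has_real_derivative 1) (at z)" by (auto intro!: derivative_eq_intros)
  from DERIV_mult'[OF Suc.IH this]
  have "((\<lambda>z. pochhammer z (Suc n)) has_real_derivative
      pochhammer z n * 1 + pochhammer z n * (\<Sum>i<n. 1 / (z + real i)) * (z + real n)) (at z)"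
    using Suc.prems by (simp add: pochhammer_Suc)
  then show ?case
    by (rule DERIV_cong) (use Suc.prems[of n] in \<open>simp add: pochhammer_Suc field_simps\<close>)
qed simp

text \<open>
  The coefficient of \<open>u\<^sup>i\<close> in the derivative carries the harmonic sum over \<open>{..<i}\<close>, which is the full
  sum minus its tail over \<open>{i..<n}\<close>. The full sum gives the multiple of \<open>P\<^sub>n\<close>, and
  \<open>jacobi_coeff_connection\<close> turns the tail into lower Jacobi polynomials.
\<close>

theorem DERIV_jacobi_poly_param:
  assumes "a + b > -2" "n > 0"
  shows "((\<lambda>a. poly (jacobi_poly n a b) t) has_real_derivative
      (\<Sum>s<n. 1 / (a + b + real n + 1 + real s)) * poly (jacobi_poly n a b) t +
      (\<Sum>j<n. jacobi_conn a b n j * poly (jacobi_poly j a b) t)) (at a)"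
proof -
  define H where "H = (\<lambda>I. \<Sum>i\<in>I. 1 / (a + b + real n + 1 + real i))"
  define u where "u = (1 + t) / 2"
  have pos: "a + b + real n + 1 + real i > 0" for i using assms by simp
  have dp: "((\<lambda>a. pochhammer (a + b + real n + 1) i) has_real_derivative
     pochhammer (a + b + real n + 1) i * H {..<i}) (at a)" for i
  proof -
    have "a + b + real n + 1 + real i \<noteq> 0" for i using pos[of i] by linarith
    then have "((\<lambda>z. pochhammer z i) has_real_derivative pochhammer (a + b + real n + 1) i * H {..<i}) (at (a + (b + real n + 1)))"
      using DERIV_pochhammer[of i "a + b + real n + 1"] by (simp add: H_def add_ac)
    from DERIV_shift[THEN iffD1, OF this] show ?thesis by (simp add: add_ac)
  qed
  have dc: "((\<lambda>a. jacobi_coeff n a b i) has_real_derivative jacobi_coeff n a b i * H {..<i}) (at a)" for i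
    unfolding jacobi_coeff_def by (rule derivative_eq_intros dp refl)+ simp
  have "((\<lambda>a. \<Sum>i\<le>n. jacobi_coeff n a b i * u ^ i) has_real_derivative
      (\<Sum>i\<le>n. jacobi_coeff n a b i * H {..<i} * u ^ i)) (at a)"
    by (rule derivative_eq_intros dc refl)+ simp
  also have "(\<Sum>i\<le>n. jacobi_coeff n a b i * H {..<i} * u ^ i)
     = (\<Sum>i\<le>n. H {..<n} * (jacobi_coeff n a b i * u ^ i) + (\<Sum>j<n. jacobi_conn a b n j * (jacobi_coeff j a b i * u ^ i)))"
  proof (rule sum.cong[OF refl])
    fix i assume "i \<in> {..n}"
    then have i: "i \<le> n" by simp
    have "H {..<n} = H {..<i} + H {i..<n}"
      unfolding H_def lessThan_atLeast0 using i by (simp add: sum.atLeastLessThan_concat)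
    then have "jacobi_coeff n a b i * H {..<i} = jacobi_coeff n a b i * H {..<n} - jacobi_coeff n a b i * H {i..<n}"
      by (simp add: algebra_simps)
    also have "\<dots> = jacobi_coeff n a b i * H {..<n} + (\<Sum>j<n. jacobi_conn a b n j * jacobi_coeff j a b i)"
      using jacobi_coeff_connection[OF assms(1) i] by (simp add: H_def)
    finally have *: "jacobi_coeff n a b i * H {..<i} = jacobi_coeff n a b i * H {..<n} + (\<Sum>j<n. jacobi_conn a b n j * jacobi_coeff j a b i)" .
    show "jacobi_coeff n a b i * H {..<i} * u ^ i = H {..<n} * (jacobi_coeff n a b i * u ^ i) + (\<Sum>j<n. jacobi_conn a b n j * (jacobi_coeff j a b i * u ^ i))"
      unfolding * distrib_right sum_distrib_right by (simp only: mult_ac)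
  qed
  also have "\<dots> = H {..<n} * (\<Sum>i\<le>n. jacobi_coeff n a b i * u ^ i) + (\<Sum>j<n. jacobi_conn a b n j * (\<Sum>i\<le>n. jacobi_coeff j a b i * u ^ i))"
    unfolding sum.distrib sum_distrib_left by (subst sum.swap[of _ "{..n}"]) simp
  also have "(\<Sum>j<n. jacobi_conn a b n j * (\<Sum>i\<le>n. jacobi_coeff j a b i * u ^ i)) = (\<Sum>j<n. jacobi_conn a b n j * poly (jacobi_poly j a b) t)"
    unfolding poly_jacobi_poly u_def[symmetric]
    by (intro sum.cong refl arg_cong2[of _ _ _ _ "(*)"] sum.mono_neutral_right) (auto simp: jacobi_coeff_def binomial_eq_0)
  finally show ?thesis by (simp add: poly_jacobi_poly u_def[symmetric] H_def)
qed

section \<open>Koornwinder polynomials\<close>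

text \<open>
  The summand \<open>s\<close> of the theorem belongs to the Jacobi polynomial of degree \<open>j = n - k - 1 - s\<close>. Since
  \<open>\<alpha> + b > -3/2\<close> for \<open>b = \<beta> + k + 1/2\<close>, the Pochhammer symbol can vanish only through its first
  factor \<open>\<alpha> + b + j + 1\<close>. If it does, \<open>a + b + j + 1 \<noteq> 0\<close> for every \<open>a \<noteq> \<alpha>\<close>, so off \<open>\<alpha>\<close> the quotient is the
  continuous \<open>jacobi_conn\<close>, whose value at \<open>\<alpha>\<close> is therefore the limit.
\<close>

lemma koornwinder_coeff_eq_jacobi_conn:
  assumes "\<alpha> > -1" "\<beta> > -1" "s < n - k"
  shows "koornwinder_coeff \<alpha> \<beta> n k s = jacobi_conn \<alpha> (\<beta> + real k + 1/2) (n - k) (n - k - Suc s)"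
proof -
  define m where "m = n - k"
  define j where "j = m - Suc s"
  define b where "b = \<beta> + real k + 1/2"
  have n: "n = m + k" and m: "m = j + Suc s" using assms by (auto simp: m_def j_def)
  have ab: "\<alpha> + b > -3/2" using assms by (simp add: b_def)
  have arg: "a + \<beta> + real n - real s + 1/2 = a + b + real j + 1" for a
    by (simp add: n m b_def)
  have quot: "koornwinder_quot a \<beta> n k s = jacobi_conn a b m j" if "a + b + real j + 1 \<noteq> 0" for a
  proof -
    have weight: "conn_weight (a + b) m j = (a + b + 1 + 2 * real j) / pochhammer (a + b + real j + 1) (s + 1)"
      using that by (subst conn_weight_eq) (auto simp: m)
    have eqs: "a + \<beta> + 2 * real n - real k - 2 * real s - 1/2 = a + b + 1 + 2 * real j"
      "a + \<beta> + 2 * real n - real k - real s + 1/2 = a + b + 1 + real m + real j"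
      "\<beta> + real n - real s + 1/2 = b + real j + 1" "m - j = s + 1"
      by (simp_all add: n m b_def)
    show ?thesis unfolding koornwinder_quot_def jacobi_conn_def arg eqs weight by (simp add: mult_ac)
  qed
  show ?thesis
  proof (cases "pochhammer (\<alpha> + b + real j + 1) (s + 1) = 0")
    case False
    then have "\<alpha> + b + real j + 1 \<noteq> 0" by (auto simp: pochhammer_rec)
    then show ?thesis using False quot by (simp add: koornwinder_coeff_def arg m_def[symmetric] b_def[symmetric] j_def[symmetric])
  next
    case True
    have "isCont (\<lambda>a. conn_weight (a + b) m j) \<alpha>"
      by (rule isCont_o2[of \<alpha> "\<lambda>a. a + b"]) (use ab in \<open>auto intro!: continuous_intros isCont_conn_weight\<close>)
    then have "isCont (\<lambda>a. jacobi_conn a b m j) \<alpha>"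
      unfolding jacobi_conn_def using ab m by (intro continuous_intros) auto
    then have "((\<lambda>a. jacobi_conn a b m j) \<longlongrightarrow> jacobi_conn \<alpha> b m j) (at \<alpha>)" by (simp add: isCont_def)
    moreover have "eventually (\<lambda>a. jacobi_conn a b m j = koornwinder_quot a \<beta> n k s) (at \<alpha>)"
    proof -
      obtain i where i: "\<alpha> + b + real j + 1 = - real i" using True by (auto simp: pochhammer_eq_0_iff)
      with ab have "i = 0" by linarith
      then have "\<alpha> + b + real j + 1 = 0" using i by simp
      moreover have "eventually (\<lambda>a. a \<noteq> \<alpha>) (at \<alpha>)" by (simp add: eventually_at_filter)
      ultimately show ?thesis by (auto elim!: eventually_mono intro!: quot[symmetric])
    qed
    ultimately have "((\<lambda>a. koornwinder_quot a \<beta> n k s) \<longlongrightarrow> jacobi_conn \<alpha> b m j) (at \<alpha>)"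
      by (rule Lim_transform_eventually)
    then have "Lim (at \<alpha>) (\<lambda>a. koornwinder_quot a \<beta> n k s) = jacobi_conn \<alpha> b m j"
      by (intro tendsto_Lim) auto
    then show ?thesis using True by (simp add: koornwinder_coeff_def arg m_def[symmetric] b_def[symmetric] j_def[symmetric])
  qed
qed

theorem theorem1:
  fixes \<alpha> \<beta> x y :: real and n k :: nat
  assumes "\<alpha> > -1" and "\<beta> > -1" and "(x, y) \<in> parabolic_biangle"
  shows "(n \<ge> k + 1 \<longrightarrow>
           ((\<lambda>a. koornwinder a \<beta> n k x y) has_real_derivative
             ((\<Sum>s = 0..n - k - 1. 1 / (\<alpha> + \<beta> + real n + real s + 3/2) * koornwinder \<alpha> \<beta> n k x y) +
              (\<Sum>s = 0..n - k - 1. koornwinder_coeff \<alpha> \<beta> n k s * koornwinder \<alpha> \<beta> (n - s - 1) k x y)))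
           (at \<alpha>)) \<and>
         (n = k \<longrightarrow>
           ((\<lambda>a. koornwinder a \<beta> n n x y) has_real_derivative 0) (at \<alpha>))"
proof (intro conjI impI)
  assume nk: "n \<ge> k + 1"
  define m where "m = n - k"
  define b where "b = \<beta> + real k + 1/2"
  define t where "t = 2 * x - 1"
  define R where "R = sqrt x ^ k * poly (jacobi_poly k \<beta> \<beta>) (y / sqrt x)"
  have m: "m > 0" and n: "n = m + k" using nk by (simp_all add: m_def)
  have K: "koornwinder a \<beta> (j + k) k x y = poly (jacobi_poly j a b) t * R" for a j
    by (simp add: koornwinder_def b_def t_def R_def mult_ac)
  have den: "\<alpha> + \<beta> + real n + real s + 3/2 = \<alpha> + b + real m + 1 + real s" for s
    by (simp add: b_def n)
  have range: "{0..n - k - 1} = {..<m}" using m by (auto simp: m_def)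
  have "((\<lambda>a. poly (jacobi_poly m a b) t * R) has_real_derivative
      ((\<Sum>s<m. 1 / (\<alpha> + b + real m + 1 + real s)) * poly (jacobi_poly m \<alpha> b) t +
      (\<Sum>j<m. jacobi_conn \<alpha> b m j * poly (jacobi_poly j \<alpha> b) t)) * R) (at \<alpha>)"
    by (intro DERIV_cmult_right DERIV_jacobi_poly_param) (use assms m in \<open>auto simp: b_def\<close>)
  also have "((\<Sum>s<m. 1 / (\<alpha> + b + real m + 1 + real s)) * poly (jacobi_poly m \<alpha> b) t +
      (\<Sum>j<m. jacobi_conn \<alpha> b m j * poly (jacobi_poly j \<alpha> b) t)) * R
    = (\<Sum>s<m. 1 / (\<alpha> + \<beta> + real n + real s + 3/2) * koornwinder \<alpha> \<beta> n k x y) +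
      (\<Sum>j<m. jacobi_conn \<alpha> b m j * koornwinder \<alpha> \<beta> (j + k) k x y)"
    unfolding den unfolding n K distrib_right sum_distrib_right by (simp only: mult.assoc)
  also have "(\<Sum>j<m. jacobi_conn \<alpha> b m j * koornwinder \<alpha> \<beta> (j + k) k x y)
    = (\<Sum>s<m. jacobi_conn \<alpha> b m (m - Suc s) * koornwinder \<alpha> \<beta> (m - Suc s + k) k x y)"
    by (rule sum.nat_diff_reindex[symmetric])
  also have "\<dots> = (\<Sum>s<m. koornwinder_coeff \<alpha> \<beta> n k s * koornwinder \<alpha> \<beta> (n - s - 1) k x y)"
    by (intro sum.cong refl) (use assms in \<open>auto simp: koornwinder_coeff_eq_jacobi_conn n b_def\<close>)
  finally show "((\<lambda>a. koornwinder a \<beta> n k x y) has_real_derivative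
             ((\<Sum>s = 0..n - k - 1. 1 / (\<alpha> + \<beta> + real n + real s + 3/2) * koornwinder \<alpha> \<beta> n k x y) +
              (\<Sum>s = 0..n - k - 1. koornwinder_coeff \<alpha> \<beta> n k s * koornwinder \<alpha> \<beta> (n - s - 1) k x y))) (at \<alpha>)"
    unfolding range by (simp add: n K)
next
  show "((\<lambda>a. koornwinder a \<beta> n n x y) has_real_derivative 0) (at \<alpha>)"
    by (simp add: koornwinder_def poly_jacobi_poly[of 0] jacobi_coeff_def)
qed

end
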